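(* Fix $L\ge1$ and vectors $\mathbf a=(a_1,\dots,a_L),\mathbf b=(b_1,\dots,b_L)$ with $a_\ell,b_\ell>0$ for all $1\le\ell\le L$, and let $u=\sum_\ell a_\ell$, $v=\sum_\ell b_\ell$. For $K\ge2$, consider the weighted stochastic block model with $K$ communities each of size $n$, where each pair of vertices independently receives a color in $\{0,1,\dots,L\}$ distributed as $p_n$ if both endpoints are in the same community and as $q_n$ otherwise, with \[ p_n(0)=1-\frac{u\log n}{n},\quad p_n(\ell)=\frac{a_\ell\log n}{n},\qquad q_n(0)=1-\frac{v\log n}{n},\quad q_n(\ell)=\frac{b_\ell\log n}{n}\quad(1\le\ell\le L). \] If \[ \sum_{\ell=1}^L\big(\sqrt{a_\ell}-\sqrt{b_\ell}\big)^2<1, \] then for any $K\ge2$ and all sufficiently large $n$, the maximum likelihood estimator of the community assignment fails with probability at least $\tfrac13$. *)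

theory Defs
  imports Complex_Main "HOL-Library.FuncSet"
begin

text \<open>Weighted stochastic block model. Vertices are 0..<K*n; the observation is a
coloring G of the unordered pairs (i,j), i<j, with colors in {0..L}.\<close>

definition pairs :: "nat \<Rightarrow> (nat \<times> nat) set" where
  "pairs N = {(i, j). i < j \<and> j < N}"

definition colorings :: "nat \<Rightarrow> nat \<Rightarrow> (nat \<times> nat \<Rightarrow> nat) set" where
  "colorings L N = (pairs N \<rightarrow>\<^sub>E {0..L})"

text \<open>Color distribution: c = a gives p_n, c = b gives q_n.\<close>
definition wdist :: "(nat \<Rightarrow> real) \<Rightarrow> nat \<Rightarrow> nat \<Rightarrow> nat \<Rightarrow> real" where
  "wdist c L n l =
     (if l = 0 then 1 - (\<Sum>m=1..L. c m) * ln (real n) / real n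
      else if l \<le> L then c l * ln (real n) / real n else 0)"

definition balanced :: "nat \<Rightarrow> nat \<Rightarrow> (nat \<Rightarrow> nat) \<Rightarrow> bool" where
  "balanced K n \<tau> \<longleftrightarrow> (\<forall>i < K * n. \<tau> i < K) \<and> (\<forall>k < K. card {i. i < K * n \<and> \<tau> i = k} = n)"

definition lik :: "(nat \<Rightarrow> real) \<Rightarrow> (nat \<Rightarrow> real) \<Rightarrow> nat \<Rightarrow> nat \<Rightarrow> nat \<Rightarrow> (nat \<Rightarrow> nat)
                   \<Rightarrow> (nat \<times> nat \<Rightarrow> nat) \<Rightarrow> real" where
  "lik a b L K n \<tau> G =
     (\<Prod>e\<in>pairs (K * n). if \<tau> (fst e) = \<tau> (snd e) then wdist a L n (G e) else wdist b L n (G e))"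

definition same_partition :: "nat \<Rightarrow> nat \<Rightarrow> (nat \<Rightarrow> nat) \<Rightarrow> (nat \<Rightarrow> nat) \<Rightarrow> bool" where
  "same_partition K n \<sigma> \<tau> \<longleftrightarrow> (\<forall>i < K * n. \<forall>j < K * n. (\<sigma> i = \<sigma> j) = (\<tau> i = \<tau> j))"

text \<open>The MLE fails (for truth sigma, observation G): the true partition is not the unique
maximizer of the likelihood over balanced assignments (up to relabelling).\<close>
definition mle_fails :: "(nat \<Rightarrow> real) \<Rightarrow> (nat \<Rightarrow> real) \<Rightarrow> nat \<Rightarrow> nat \<Rightarrow> nat \<Rightarrow> (nat \<Rightarrow> nat)
                         \<Rightarrow> (nat \<times> nat \<Rightarrow> nat) \<Rightarrow> bool" where
  "mle_fails a b L K n \<sigma> G \<longleftrightarrow>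
     (\<exists>\<tau>. balanced K n \<tau> \<and> \<not> same_partition K n \<sigma> \<tau> \<and> lik a b L K n \<tau> G \<ge> lik a b L K n \<sigma> G)"

definition wsbm_prob :: "(nat \<Rightarrow> real) \<Rightarrow> (nat \<Rightarrow> real) \<Rightarrow> nat \<Rightarrow> nat \<Rightarrow> nat \<Rightarrow> (nat \<Rightarrow> nat)
                         \<Rightarrow> ((nat \<times> nat \<Rightarrow> nat) \<Rightarrow> bool) \<Rightarrow> real" where
  "wsbm_prob a b L K n \<sigma> E = (\<Sum>G\<in>{G \<in> colorings L (K * n). E G}. lik a b L K n \<sigma> G)"

end

theory Submission
  imports Defs "HOL-Real_Asymp.Real_Asymp"
begin

text \<open>Take two communities \<open>A\<close>, \<open>B\<close> and subsets \<open>HA \<subseteq> A\<close>, \<open>HB \<subseteq> B\<close> of size \<open>h\<close> of order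
  \<open>n / log n\<close>. Call \<open>i \<in> HA\<close> bad if its edges to the vertices of \<open>A \<union> B\<close> outside \<open>HA \<union> HB\<close> are
  at least as likely under membership in \<open>B\<close> as under membership in \<open>A\<close>, and similarly for
  \<open>j \<in> HB\<close>. Badness of different vertices of \<open>HA\<close> is independent, and exponential tilting shows
  that each vertex is bad with probability at least \<open>n powr (- I - o(1))\<close>, where
  \<open>I = (\<Sum>l. (sqrt (a l) - sqrt (b l))\<^sup>2) < 1\<close>; hence bad \<open>i\<close> and \<open>j\<close> exist with high probability.
  The edges inside \<open>HA \<union> HB\<close> are independent of badness, and by the choice of \<open>h\<close> all those at
  \<open>i\<close> or \<open>j\<close> have colour 0 with probability at least 2/3. In that case they contribute nothing to
  the likelihood ratio of swapping \<open>i\<close> and \<open>j\<close>, so the swap does not decrease the likelihood.\<close>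

subsection \<open>Product measures as finite sums\<close>

text \<open>The weights are not required to sum to 1: tilting produces unnormalised ones.\<close>

definition expct :: "'e set \<Rightarrow> 'c set \<Rightarrow> ('e \<Rightarrow> 'c \<Rightarrow> real) \<Rightarrow> (('e \<Rightarrow> 'c) \<Rightarrow> real) \<Rightarrow> real" where
  "expct E C w F = (\<Sum>G\<in>E \<rightarrow>\<^sub>E C. (\<Prod>e\<in>E. w e (G e)) * F G)"

text \<open>Quantifies over all functions, not only extensional ones, so that constant functions and
  glued colourings may be substituted for \<open>G\<close>.\<close>

definition depends_on :: "'e set \<Rightarrow> (('e \<Rightarrow> 'c) \<Rightarrow> 'd) \<Rightarrow> bool" where
  "depends_on E F \<longleftrightarrow> (\<forall>G G'. (\<forall>e\<in>E. G e = G' e) \<longrightarrow> F G = F G')"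

lemma depends_onD: "depends_on E F \<Longrightarrow> (\<And>e. e \<in> E \<Longrightarrow> G e = G' e) \<Longrightarrow> F G = F G'"
  by (auto simp: depends_on_def)

lemma expct_cong:
  assumes "\<And>e c. e \<in> E \<Longrightarrow> c \<in> C \<Longrightarrow> w e c = w' e c"
    and "\<And>G. G \<in> E \<rightarrow>\<^sub>E C \<Longrightarrow> F G = F' G"
  shows "expct E C w F = expct E C w' F'"
  unfolding expct_def using assms
  by (intro sum.cong refl arg_cong2[where f = "(*)"] prod.cong) (auto simp: PiE_mem)

lemma expct_mono:
  assumes "\<And>e c. e \<in> E \<Longrightarrow> c \<in> C \<Longrightarrow> w e c \<ge> 0"
    and "\<And>G. G \<in> E \<rightarrow>\<^sub>E C \<Longrightarrow> F G \<le> F' G"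
  shows "expct E C w F \<le> expct E C w F'"
  unfolding expct_def using assms
  by (intro sum_mono mult_left_mono prod_nonneg) (auto simp: PiE_mem)

lemma expct_add: "expct E C w (\<lambda>G. F G + F' G) = expct E C w F + expct E C w F'"
  by (simp add: expct_def distrib_left sum.distrib)

lemma expct_diff: "expct E C w (\<lambda>G. F G - F' G) = expct E C w F - expct E C w F'"
  by (simp add: expct_def right_diff_distrib sum_subtractf)

lemma expct_mult_left: "expct E C w (\<lambda>G. k * F G) = k * expct E C w F"
  by (simp add: expct_def sum_distrib_left mult_ac)

lemma expct_mult_right: "expct E C w (\<lambda>G. F G * k) = expct E C w F * k"
  by (simp add: expct_def sum_distrib_left mult_ac)

lemma expct_sum: "expct E C w (\<lambda>G. \<Sum>i\<in>I. F i G) = (\<Sum>i\<in>I. expct E C w (F i))"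
  unfolding expct_def sum_distrib_left by (rule sum.swap)

lemma expct_const:
  assumes "finite E" "finite C"
  shows "expct E C w (\<lambda>_. k) = (\<Prod>e\<in>E. \<Sum>c\<in>C. w e c) * k"
proof -
  have "expct E C w (\<lambda>_. k) = (\<Sum>G\<in>E \<rightarrow>\<^sub>E C. (\<Prod>e\<in>E. w e (G e))) * k"
    by (simp add: expct_def sum_distrib_right)
  then show ?thesis
    by (simp add: prod_sum_PiE assms)
qed

text \<open>Fubini for finite products: a function on the union corresponds to its two restrictions,
  and the weight factorises. This form later permits conditioning on the edges in
  \<open>E1\<close>.\<close>

lemma expct_union:
  assumes "finite E1" "finite E2" "E1 \<inter> E2 = {}"
  shows "expct (E1 \<union> E2) C w F =
    expct E1 C w (\<lambda>G1. expct E2 C w (\<lambda>G2. F (\<lambda>e. if e \<in> E1 then G1 e else G2 e)))"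
proof -
  have "expct (E1 \<union> E2) C w F =
    (\<Sum>(G1, G2)\<in>(E1 \<rightarrow>\<^sub>E C) \<times> (E2 \<rightarrow>\<^sub>E C).
       (\<Prod>e\<in>E1. w e (G1 e)) * ((\<Prod>e\<in>E2. w e (G2 e)) * F (\<lambda>e. if e \<in> E1 then G1 e else G2 e)))"
    unfolding expct_def
  proof (rule sum.reindex_bij_witness
      [where j = "\<lambda>G. (restrict G E1, restrict G E2)"
         and i = "\<lambda>(G1, G2) e. if e \<in> E1 then G1 e else G2 e"], goal_cases)
    case (5 G)
    have *: "(\<lambda>e. if e \<in> E1 then restrict G E1 e else restrict G E2 e) = G"
      using 5 assms(3) by (auto simp: fun_eq_iff PiE_iff extensional_def)
    show ?case
      unfolding prod.case * by (simp add: prod.union_disjoint assms mult.assoc)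
  qed (use assms(3) in \<open>auto simp: fun_eq_iff PiE_iff extensional_def\<close>)
  also have "\<dots> = expct E1 C w (\<lambda>G1. expct E2 C w (\<lambda>G2. F (\<lambda>e. if e \<in> E1 then G1 e else G2 e)))"
    unfolding expct_def by (simp add: sum.cartesian_product[symmetric] sum_distrib_left)
  finally show ?thesis .
qed

lemma expct_empty [simp]: "expct {} C w F = F (\<lambda>_. undefined)"
  by (simp add: expct_def)

lemma expct_singleton:
  assumes "finite C" "depends_on {e} F"
  shows "expct {e} C w F = (\<Sum>c\<in>C. w e c * F (\<lambda>_. c))"
  unfolding expct_def
proof (rule sum.reindex_bij_witness[where j = "\<lambda>G. G e" and i = "\<lambda>c. restrict (\<lambda>_. c) {e}"], goal_cases)
  case (5 G)
  have "F (\<lambda>_. G e) = F G"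
    by (rule depends_onD[OF assms(2)]) auto
  then show ?case by simp
qed (auto simp: fun_eq_iff PiE_iff extensional_def)

lemma expct_mult_indep:
  assumes "finite E1" "finite E2" "E1 \<inter> E2 = {}" "depends_on E1 F1" "depends_on E2 F2"
  shows "expct (E1 \<union> E2) C w (\<lambda>G. F1 G * F2 G) = expct E1 C w F1 * expct E2 C w F2"
proof -
  have "F1 (\<lambda>e. if e \<in> E1 then G1 e else G2 e) = F1 G1" for G1 G2
    by (rule depends_onD[OF assms(4)]) auto
  moreover have "F2 (\<lambda>e. if e \<in> E1 then G1 e else G2 e) = F2 G2" for G1 G2
    by (rule depends_onD[OF assms(5)]) (use assms(3) in auto)
  ultimately show ?thesis
    by (simp add: expct_union assms(1-3) expct_mult_left expct_mult_right)
qed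

text \<open>The coordinates outside \<open>E'\<close> split off as an independent factor, which is a
  product of total masses 1.\<close>

lemma expct_marginal:
  assumes "finite E" "finite C" "E' \<subseteq> E" "depends_on E' F"
    and "\<And>e. e \<in> E \<Longrightarrow> (\<Sum>c\<in>C. w e c) = 1"
  shows "expct E C w F = expct E' C w F"
proof -
  have "expct (E' \<union> (E - E')) C w (\<lambda>G. F G * 1) = expct E' C w F * expct (E - E') C w (\<lambda>_. 1)"
    by (rule expct_mult_indep) (use assms finite_subset in \<open>auto simp: depends_on_def\<close>)
  moreover have "E' \<union> (E - E') = E"
    using assms(3) by auto
  ultimately show ?thesis
    using assms by (simp add: expct_const)
qed

lemma expct_prod_indep:
  fixes E :: "'i \<Rightarrow> 'e set" and F :: "'i \<Rightarrow> ('e \<Rightarrow> 'c) \<Rightarrow> real"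
  assumes "finite I" "\<And>i. i \<in> I \<Longrightarrow> finite (E i)"
    and "\<And>i j. i \<in> I \<Longrightarrow> j \<in> I \<Longrightarrow> i \<noteq> j \<Longrightarrow> E i \<inter> E j = {}"
    and "\<And>i. i \<in> I \<Longrightarrow> depends_on (E i) (F i)"
  shows "expct (\<Union>i\<in>I. E i) C w (\<lambda>G. \<Prod>i\<in>I. F i G) = (\<Prod>i\<in>I. expct (E i) C w (F i))"
  using assms
proof (induction I rule: finite_induct)
  case empty
  then show ?case by simp
next
  case (insert x I)
  have dep: "depends_on (\<Union>i\<in>I. E i) (\<lambda>G. \<Prod>i\<in>I. F i G)"
    unfolding depends_on_def
  proof (intro allI impI prod.cong refl)
    fix G G' :: "'e \<Rightarrow> 'c" and i assume "\<forall>e\<in>\<Union> (E ` I). G e = G' e" "i \<in> I"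
    then show "F i G = F i G'"
      using depends_onD[OF insert.prems(3)[of i], of G G'] by blast
  qed
  have "expct (\<Union>i\<in>insert x I. E i) C w (\<lambda>G. \<Prod>i\<in>insert x I. F i G)
      = expct (E x \<union> (\<Union>i\<in>I. E i)) C w (\<lambda>G. F x G * (\<Prod>i\<in>I. F i G))"
    using insert.hyps by simp
  also have "\<dots> = expct (E x) C w (F x) * expct (\<Union>i\<in>I. E i) C w (\<lambda>G. \<Prod>i\<in>I. F i G)"
  proof (rule expct_mult_indep)
    show "E x \<inter> (\<Union>i\<in>I. E i) = {}"
      using insert.prems(2)[of x] insert.hyps(2) by blast
  qed (use insert dep in auto)
  also have "expct (\<Union>i\<in>I. E i) C w (\<lambda>G. \<Prod>i\<in>I. F i G) = (\<Prod>i\<in>I. expct (E i) C w (F i))"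
    using insert.prems by (intro insert.IH) auto
  finally show ?case
    using insert.hyps by simp
qed

text \<open>Variances of independent centred variables add: when one coordinate \<open>x\<close> is
  split off, the cross term has the mean of \<open>Y x\<close> as a factor and vanishes.\<close>

lemma expct_sum_centered:
  fixes Y :: "'e \<Rightarrow> 'c \<Rightarrow> real"
  assumes "finite E" "finite C"
    and "\<And>e. e \<in> E \<Longrightarrow> (\<Sum>c\<in>C. w e c) = 1"
    and "\<And>e. e \<in> E \<Longrightarrow> (\<Sum>c\<in>C. w e c * Y e c) = 0"
  shows "expct E C w (\<lambda>G. (\<Sum>e\<in>E. Y e (G e))\<^sup>2) = (\<Sum>e\<in>E. \<Sum>c\<in>C. w e c * (Y e c)\<^sup>2)"
  using assms
proof (induction E rule: finite_induct)
  case empty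
  then show ?case by simp
next
  case (insert x E)
  define S where "S = (\<lambda>G. \<Sum>e\<in>E. Y e (G e))"
  have depx: "depends_on {x} (\<lambda>G. f (G x))" for f :: "'c \<Rightarrow> real"
    by (simp add: depends_on_def)
  have depS: "depends_on E (\<lambda>G. f (S G))" for f :: "real \<Rightarrow> real"
    by (simp add: depends_on_def S_def)
  have ind: "expct (insert x E) C w (\<lambda>G. f (G x) * g (S G))
      = (\<Sum>c\<in>C. w x c * f c) * expct E C w (\<lambda>G. g (S G))" for f g
    using expct_mult_indep[of "{x}" E "\<lambda>G. f (G x)" "\<lambda>G. g (S G)" C w] insert depx depS
    by (simp add: expct_singleton)
  \<comment> \<open>The redundant factors 1 bring each summand into the shape
    \<open>f (G x) * g (S G)\<close> that \<open>ind\<close> factorises.\<close>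
  have "expct (insert x E) C w (\<lambda>G. (\<Sum>e\<in>insert x E. Y e (G e))\<^sup>2) =
      expct (insert x E) C w (\<lambda>G. (Y x (G x))\<^sup>2 * 1 + (2 * Y x (G x) * S G + 1 * (S G)\<^sup>2))"
    using insert.hyps by (intro expct_cong) (simp_all add: S_def power2_eq_square algebra_simps)
  also have "\<dots> = (\<Sum>c\<in>C. w x c * (Y x c)\<^sup>2) * expct E C w (\<lambda>G. 1)
      + ((\<Sum>c\<in>C. w x c * (2 * Y x c)) * expct E C w S + (\<Sum>c\<in>C. w x c * 1) * expct E C w (\<lambda>G. (S G)\<^sup>2))"
    unfolding expct_add
    by (simp only: ind[of "\<lambda>c. (Y x c)\<^sup>2" "\<lambda>_. 1"] ind[of "\<lambda>c. 2 * Y x c" "\<lambda>s. s"]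
        ind[of "\<lambda>_. 1" "\<lambda>s. s\<^sup>2"])
  also have "(\<Sum>c\<in>C. w x c * (2 * Y x c)) = 2 * (\<Sum>c\<in>C. w x c * Y x c)"
    by (simp add: sum_distrib_left mult_ac)
  also have "(\<Sum>c\<in>C. w x c * Y x c) = 0"
    using insert.prems by simp
  also have "expct E C w (\<lambda>G. (S G)\<^sup>2) = (\<Sum>e\<in>E. \<Sum>c\<in>C. w e c * (Y e c)\<^sup>2)"
    unfolding S_def using insert.prems by (intro insert.IH) auto
  also have "expct E C w (\<lambda>G. 1) = 1"
    using insert by (simp add: expct_const)
  also have "(\<Sum>c\<in>C. w x c * 1) = 1"
    using insert.prems by simp
  finally show ?case
    using insert.hyps by simp
qed

subsection \<open>The log-likelihood ratio of a single vertex\<close>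

text \<open>All coordinates carry the same weight, so the measure is invariant under any permutation
  of coordinates; equal cardinalities provide one that exchanges \<open>U\<close> and
  \<open>V\<close>.\<close>

lemma expct_swap:
  fixes w :: "'c \<Rightarrow> real" and X :: "'c \<Rightarrow> real"
  assumes "finite U" "finite V" "U \<inter> V = {}" "card U = card V"
  shows "expct (U \<union> V) C (\<lambda>_. w) (\<lambda>G. f ((\<Sum>e\<in>U. X (G e)) - (\<Sum>e\<in>V. X (G e))))
       = expct (U \<union> V) C (\<lambda>_. w) (\<lambda>G. f ((\<Sum>e\<in>V. X (G e)) - (\<Sum>e\<in>U. X (G e))))"
proof -
  obtain h where h: "bij_betw h U V"
    using assms by (metis finite_same_card_bij)
  \<comment> \<open>An involution, hence its own inverse in the reindexing below. It fixes every
    point outside \<open>U \<union> V\<close>, so \<open>G \<circ> \<pi>\<close> stays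
    extensional.\<close>
  define \<pi> where "\<pi> = (\<lambda>e. if e \<in> U then h e else if e \<in> V then inv_into U h e else e)"
  have \<pi>U: "bij_betw \<pi> U V"
    using h by (subst bij_betw_cong[of U \<pi> h]) (auto simp: \<pi>_def)
  have \<pi>V: "bij_betw \<pi> V U"
    using bij_betw_inv_into[OF h] assms(3)
    by (subst bij_betw_cong[of V \<pi> "inv_into U h"]) (auto simp: \<pi>_def)
  have \<pi>UV: "bij_betw \<pi> (U \<union> V) (U \<union> V)"
    using bij_betw_combine[OF \<pi>U \<pi>V] assms(3) by (simp add: Un_commute Int_commute)
  have inU: "h e \<in> V" "inv_into U h (h e) = e" if "e \<in> U" for e
    using h that by (auto simp: bij_betw_def)
  have inV: "inv_into U h e \<in> U" "h (inv_into U h e) = e" if "e \<in> V" for e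
    using bij_betw_inv_into[OF h] h that
    by (auto simp: bij_betw_def inv_into_into f_inv_into_f)
  have inv: "\<pi> (\<pi> e) = e" for e
    using inU inV assms(3) by (auto simp: \<pi>_def)
  have out: "\<pi> e = e" if "e \<notin> U" "e \<notin> V" for e
    using that by (simp add: \<pi>_def)
  have mem: "\<pi> e \<in> U \<union> V \<longleftrightarrow> e \<in> U \<union> V" for e
    using inU inV assms(3) by (auto simp: \<pi>_def)
  have PiE: "G \<circ> \<pi> \<in> (U \<union> V) \<rightarrow>\<^sub>E C" if "G \<in> (U \<union> V) \<rightarrow>\<^sub>E C" for G
  proof (rule PiE_I)
    fix e assume "e \<in> U \<union> V"
    then show "(G \<circ> \<pi>) e \<in> C"
      using PiE_mem[OF that, of "\<pi> e"] mem[of e] by simp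
  next
    fix e assume "e \<notin> U \<union> V"
    then show "(G \<circ> \<pi>) e = undefined"
      using that out[of e] by (auto simp: PiE_iff extensional_def)
  qed
  have sumU: "(\<Sum>e\<in>U. g (\<pi> e)) = (\<Sum>e\<in>V. g e)" for g :: "'a \<Rightarrow> real"
    by (rule sum.reindex_bij_betw[OF \<pi>U])
  have sumV: "(\<Sum>e\<in>V. g (\<pi> e)) = (\<Sum>e\<in>U. g e)" for g :: "'a \<Rightarrow> real"
    by (rule sum.reindex_bij_betw[OF \<pi>V])
  have prodUV: "(\<Prod>e\<in>U \<union> V. g (\<pi> e)) = (\<Prod>e\<in>U \<union> V. g e)" for g :: "'a \<Rightarrow> real"
    by (rule prod.reindex_bij_betw[OF \<pi>UV])
  show ?thesis
    unfolding expct_def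
  proof (rule sum.reindex_bij_witness[where i = "\<lambda>G. G \<circ> \<pi>" and j = "\<lambda>G. G \<circ> \<pi>"], goal_cases)
    case (5 G)
    show ?case
      using sumU[of "\<lambda>e. X (G e)"] sumV[of "\<lambda>e. X (G e)"] prodUV[of "\<lambda>e. w (G e)"] by simp
  qed (auto intro!: PiE simp: fun_eq_iff inv)
qed

text \<open>The minorant is quadratic in \<open>s\<close>, so that a second moment bound suffices.\<close>

lemma exp_neg_half_abs_ge:
  fixes s t :: real
  assumes "t > 0"
  shows "exp (- t) * (1 + t / 2 - s\<^sup>2 / (8 * t)) \<le> exp (- \<bar>s\<bar> / 2)"
proof -
  \<comment> \<open>Bounds the absolute value of \<open>s\<close> by a parabola touching it at
    \<open>2 * t\<close>; the exponential is then bounded below by its tangent line at 0.\<close>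
  have "0 \<le> (\<bar>s\<bar> - 2 * t)\<^sup>2 / (8 * t)"
    using assms by simp
  also have "\<dots> = s\<^sup>2 / (8 * t) - \<bar>s\<bar> / 2 + t / 2"
    using assms by (simp add: power2_diff field_simps power2_eq_square)
  finally have "1 + t / 2 - s\<^sup>2 / (8 * t) \<le> 1 + (t - \<bar>s\<bar> / 2)"
    by simp
  also have "\<dots> \<le> exp (t - \<bar>s\<bar> / 2)"
    by (rule exp_ge_add_one_self)
  finally have "exp (- t) * (1 + t / 2 - s\<^sup>2 / (8 * t)) \<le> exp (- t) * exp (t - \<bar>s\<bar> / 2)"
    by (simp add: mult_left_mono)
  then show ?thesis
    by (simp add: exp_add[symmetric])
qed

text \<open>Since \<open>U\<close> and \<open>V\<close> have equal size, the means cancel in the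
  difference, and the second moment is a variance of independent terms.\<close>

lemma expct_sum_diff_second_moment:
  fixes r :: "'c \<Rightarrow> real" and X :: "'c \<Rightarrow> real"
  assumes "finite U" "finite V" "U \<inter> V = {}" "card U = card V"
    and "finite C" "\<And>c. c \<in> C \<Longrightarrow> r c \<ge> 0" "(\<Sum>c\<in>C. r c) = 1"
  shows "expct (U \<union> V) C (\<lambda>_. r) (\<lambda>G. ((\<Sum>e\<in>U. X (G e)) - (\<Sum>e\<in>V. X (G e)))\<^sup>2)
       \<le> 2 * real (card U) * (\<Sum>c\<in>C. r c * (X c)\<^sup>2)"
proof -
  define \<mu> where "\<mu> = (\<Sum>c\<in>C. r c * X c)"
  \<comment> \<open>The sign on \<open>V\<close> is absorbed into the summand, which turns the
    difference into one centred sum over \<open>U \<union> V\<close>.\<close>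
  define Y where "Y = (\<lambda>e c. if e \<in> U then X c - \<mu> else \<mu> - X c)"
  have centered: "(\<Sum>c\<in>C. r c * (X c - \<mu>)) = 0"
    using assms(7) by (simp add: right_diff_distrib sum_subtractf \<mu>_def flip: sum_distrib_right)
  then have Y0: "(\<Sum>c\<in>C. r c * Y e c) = 0" for e
    unfolding Y_def by (cases "e \<in> U") (simp_all add: right_diff_distrib sum_subtractf)
  have Y2: "(Y e c)\<^sup>2 = (X c - \<mu>)\<^sup>2" for e c
    by (simp add: Y_def power2_commute)
  have YS: "(\<Sum>e\<in>U \<union> V. Y e (G e)) = (\<Sum>e\<in>U. X (G e)) - (\<Sum>e\<in>V. X (G e))" for G
  proof -
    have "(\<Sum>e\<in>U. Y e (G e)) = (\<Sum>e\<in>U. X (G e) - \<mu>)"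
      by (simp add: Y_def)
    moreover have "(\<Sum>e\<in>V. Y e (G e)) = (\<Sum>e\<in>V. \<mu> - X (G e))"
      using assms(3) by (intro sum.cong) (auto simp: Y_def)
    ultimately show ?thesis
      by (simp add: sum.union_disjoint assms(1-3) sum_subtractf assms(4))
  qed
  have "expct (U \<union> V) C (\<lambda>_. r) (\<lambda>G. ((\<Sum>e\<in>U. X (G e)) - (\<Sum>e\<in>V. X (G e)))\<^sup>2)
      = (\<Sum>e\<in>U \<union> V. \<Sum>c\<in>C. r c * (Y e c)\<^sup>2)"
    unfolding YS[symmetric] using assms Y0 by (intro expct_sum_centered) auto
  also have "\<dots> = 2 * real (card U) * (\<Sum>c\<in>C. r c * (X c - \<mu>)\<^sup>2)"
    by (simp add: Y2 card_Un_disjoint assms)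
  also have "(\<Sum>c\<in>C. r c * (X c - \<mu>)\<^sup>2)
      = (\<Sum>c\<in>C. r c * (X c)\<^sup>2) - 2 * \<mu> * (\<Sum>c\<in>C. r c * X c) + \<mu>\<^sup>2 * (\<Sum>c\<in>C. r c)"
    unfolding sum_distrib_left sum_subtractf[symmetric] sum.distrib[symmetric]
    by (intro sum.cong) (auto simp: power2_eq_square algebra_simps)
  also have "\<dots> = (\<Sum>c\<in>C. r c * (X c)\<^sup>2) - \<mu>\<^sup>2"
    by (simp add: \<mu>_def[symmetric] assms(7) power2_eq_square)
  also have "2 * real (card U) * \<dots> \<le> 2 * real (card U) * (\<Sum>c\<in>C. r c * (X c)\<^sup>2)"
    by (intro mult_left_mono) auto
  finally show ?thesis .
qed

text \<open>Exponential tilting by the factor 1/2 replaces both \<open>p\<close> and \<open>q\<close> by \<open>sqrt (p * q)\<close>; under the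
  tilted measure the log-likelihood ratio is symmetric.\<close>

lemma llr_nonneg_lower_bound:
  fixes p q :: "'c \<Rightarrow> real"
  defines "X \<equiv> \<lambda>c. ln (q c) - ln (p c)"
    and "Z \<equiv> \<lambda>C. \<Sum>c\<in>C. sqrt (p c * q c)"
  assumes fin: "finite U" "finite V" and disj: "U \<inter> V = {}" and card: "card U = m" "card V = m"
    and C: "finite C" "C \<noteq> {}" and pos: "\<And>c. c \<in> C \<Longrightarrow> p c > 0" "\<And>c. c \<in> C \<Longrightarrow> q c > 0"
    and wU: "\<And>e. e \<in> U \<Longrightarrow> w e = p" and wV: "\<And>e. e \<in> V \<Longrightarrow> w e = q"
    and t: "t > 0" and moment: "2 * real m * (\<Sum>c\<in>C. sqrt (p c * q c) * (X c)\<^sup>2) \<le> 4 * t\<^sup>2 * Z C"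
  shows "exp (- t) * Z C ^ (2 * m) / 2 \<le>
    expct (U \<union> V) C w (\<lambda>G. of_bool ((\<Sum>e\<in>V. X (G e)) \<le> (\<Sum>e\<in>U. X (G e))))"
proof -
  define s where "s = (\<lambda>c. sqrt (p c * q c))"
  define r where "r = (\<lambda>c. s c / Z C)"
  define S where "S = (\<lambda>G. (\<Sum>e\<in>U. X (G e)) - (\<Sum>e\<in>V. X (G e)))"
  have s_pos: "s c > 0" if "c \<in> C" for c
    using pos that by (simp add: s_def)
  have Z_pos: "Z C > 0"
    unfolding Z_def using C s_pos by (intro sum_pos) (auto simp: s_def)
  have r_nonneg: "r c \<ge> 0" if "c \<in> C" for c
    using s_pos[OF that] Z_pos by (simp add: r_def)
  have r_sum: "(\<Sum>c\<in>C. r c) = 1"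
    using Z_pos by (simp add: r_def Z_def s_def flip: sum_divide_distrib)
  \<comment> \<open>The tilt: \<open>p\<close> and \<open>q\<close> differ from their geometric mean
    by opposite factors, so the log-likelihood ratio \<open>S\<close> carries all the asymmetry of
    the weights.\<close>
  have p_eq: "p c = s c * exp (- X c / 2)" and q_eq: "q c = s c * exp (X c / 2)" if "c \<in> C" for c
  proof -
    have s': "s c = exp ((ln (p c) + ln (q c)) / 2)"
    proof -
      have "(exp ((ln (p c) + ln (q c)) / 2))\<^sup>2 = exp (ln (p c) + ln (q c))"
        by (simp add: power2_eq_square flip: exp_add)
      also have "\<dots> = p c * q c"
        using pos that by (simp add: exp_add)
      finally show ?thesis
        unfolding s_def by (intro real_sqrt_unique) auto
    qed
    show "p c = s c * exp (- X c / 2)" "q c = s c * exp (X c / 2)"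
      unfolding s' exp_add[symmetric] using pos that
      by (simp_all add: X_def field_simps)
  qed
  have weight: "(\<Prod>e\<in>U \<union> V. w e (G e)) = (\<Prod>e\<in>U \<union> V. s (G e)) * exp (- S G / 2)"
    if "G \<in> (U \<union> V) \<rightarrow>\<^sub>E C" for G
  proof -
    have GC: "G e \<in> C" if "e \<in> U \<union> V" for e
      using PiE_mem[OF \<open>G \<in> _\<close> that] .
    have "(\<Prod>e\<in>U. w e (G e)) = (\<Prod>e\<in>U. s (G e) * exp (- X (G e) / 2))"
      by (intro prod.cong refl) (metis GC UnI1 p_eq wU)
    moreover have "(\<Prod>e\<in>V. w e (G e)) = (\<Prod>e\<in>V. s (G e) * exp (X (G e) / 2))"
      by (intro prod.cong refl) (metis GC UnI2 q_eq wV)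
    moreover have "exp (- S G / 2) = (\<Prod>e\<in>U. exp (- X (G e) / 2)) * (\<Prod>e\<in>V. exp (X (G e) / 2))"
      by (simp add: fin exp_sum[symmetric] exp_add[symmetric] S_def sum_negf sum_divide_distrib[symmetric]
          diff_divide_distrib)
    ultimately show ?thesis
      by (simp add: prod.union_disjoint fin disj prod.distrib)
  qed
  define P where "P = expct (U \<union> V) C w (\<lambda>G. of_bool ((\<Sum>e\<in>V. X (G e)) \<le> (\<Sum>e\<in>U. X (G e))))"
  define f where "f = (\<lambda>x. exp (- x / 2) * of_bool (0 \<le> x) :: real)"
  have P1: "P = expct (U \<union> V) C (\<lambda>_. s) (\<lambda>G. f (S G))"
  proof -
    have "(\<Sum>e\<in>V. X (G e)) \<le> (\<Sum>e\<in>U. X (G e)) \<longleftrightarrow> 0 \<le> S G" for G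
      by (simp add: S_def)
    then show ?thesis
      unfolding P_def expct_def by (intro sum.cong refl) (simp add: weight f_def)
  qed
  \<comment> \<open>The weight \<open>s\<close> is the same on \<open>U\<close> and
    \<open>V\<close>, so \<open>S\<close> may be replaced by its negative.\<close>
  have P2: "P = expct (U \<union> V) C (\<lambda>_. s) (\<lambda>G. f (- S G))"
    unfolding P1 S_def using expct_swap[of U V C s f X] fin disj card by simp
  \<comment> \<open>Normalises \<open>s\<close> to the probability weight \<open>r\<close>; the lost
    mass, one factor \<open>Z C\<close> for each of the \<open>2 * m\<close> edges, is the main term
    of the bound.\<close>
  have scale: "expct (U \<union> V) C (\<lambda>_. s) F = Z C ^ (2 * m) * expct (U \<union> V) C (\<lambda>_. r) F" for F
  proof -
    have "(\<Prod>e\<in>U \<union> V. s (G e)) = Z C ^ (2 * m) * (\<Prod>e\<in>U \<union> V. r (G e))" for G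
      using Z_pos fin disj card by (simp add: r_def prod_dividef card_Un_disjoint mult_2)
    then show ?thesis
      by (simp add: expct_def sum_distrib_left mult_ac)
  qed
  have "expct (U \<union> V) C (\<lambda>_. r) (\<lambda>G. (S G)\<^sup>2) \<le> 2 * real (card U) * (\<Sum>c\<in>C. r c * (X c)\<^sup>2)"
    unfolding S_def using fin disj card C r_nonneg r_sum by (intro expct_sum_diff_second_moment) auto
  also have "\<dots> = 2 * real m * (\<Sum>c\<in>C. s c * (X c)\<^sup>2) / Z C"
    by (simp add: r_def card flip: sum_divide_distrib)
  also have "\<dots> \<le> 4 * t\<^sup>2"
    using moment Z_pos by (simp add: s_def field_simps)
  finally have second: "expct (U \<union> V) C (\<lambda>_. r) (\<lambda>G. (S G)\<^sup>2) \<le> 4 * t\<^sup>2" .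
  \<comment> \<open>The bound \<open>4 * t\<^sup>2\<close> on the second moment is exactly what the
    gain \<open>t / 2\<close> of the minorant can absorb.\<close>
  have "1 \<le> 1 + t / 2 - 4 * t\<^sup>2 / (8 * t)"
    using t by (simp add: power2_eq_square)
  also have "\<dots> \<le> 1 + t / 2 - expct (U \<union> V) C (\<lambda>_. r) (\<lambda>G. (S G)\<^sup>2) / (8 * t)"
    using second t by (intro diff_left_mono divide_right_mono) auto
  also have "\<dots> = expct (U \<union> V) C (\<lambda>_. r) (\<lambda>G. 1 + t / 2 - (S G)\<^sup>2 * (1 / (8 * t)))"
    unfolding expct_diff expct_mult_right using fin C r_sum by (simp add: expct_const)
  finally have "exp (- t) * 1 \<le> exp (- t) * expct (U \<union> V) C (\<lambda>_. r) (\<lambda>G. 1 + t / 2 - (S G)\<^sup>2 * (1 / (8 * t)))"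
    by (intro mult_left_mono) auto
  also have "\<dots> \<le> expct (U \<union> V) C (\<lambda>_. r) (\<lambda>G. exp (- \<bar>S G\<bar> / 2))"
    unfolding expct_mult_left[symmetric] using exp_neg_half_abs_ge[OF t] r_nonneg
    by (intro expct_mono) auto
  finally have "Z C ^ (2 * m) * (exp (- t) * 1) \<le> expct (U \<union> V) C (\<lambda>_. s) (\<lambda>G. exp (- \<bar>S G\<bar> / 2))"
    unfolding scale using Z_pos by (intro mult_left_mono) auto
  \<comment> \<open>One of the two terms is present for each sign of \<open>S G\<close>. Both have
    expectation \<open>P\<close>, whence the factor 1/2 in the result.\<close>
  also have "\<dots> \<le> expct (U \<union> V) C (\<lambda>_. s) (\<lambda>G. f (S G) + f (- S G))"
    using s_pos by (intro expct_mono) (auto simp: f_def less_imp_le abs_if)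
  also have "\<dots> = 2 * P"
    unfolding expct_add P1[symmetric] P2[symmetric] by simp
  finally show ?thesis
    by (simp add: P_def mult_ac)
qed

subsection \<open>Swapping two vertices\<close>

definition edge :: "nat \<Rightarrow> nat \<Rightarrow> nat \<times> nat" where
  "edge i v = (min i v, max i v)"

lemma edge_commute: "edge i v = edge v i"
  by (simp add: edge_def min.commute max.commute)

lemma edge_inject: "edge i v = edge i v' \<longleftrightarrow> v = v'"
  by (auto simp: edge_def min_def max_def split: if_splits)

text \<open>Equality would make \<open>i\<close> one of the endpoints \<open>j\<close> and
  \<open>v'\<close>. This is the source of disjointness, hence independence, of the edge sets at
  different vertices.\<close>

lemma edge_cross_neq: "i \<noteq> v' \<Longrightarrow> i \<noteq> j \<Longrightarrow> edge i v \<noteq> edge j v'"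
  by (auto simp: edge_def min_def max_def split: if_splits)

lemma inj_on_edge: "inj_on (edge i) W"
  by (simp add: inj_on_def edge_inject)

lemma edge_in_pairs: "i < N \<Longrightarrow> v < N \<Longrightarrow> i \<noteq> v \<Longrightarrow> edge i v \<in> pairs N"
  by (auto simp: edge_def pairs_def min_def max_def)

lemma pairs_edgeE:
  assumes "e \<in> pairs N"
  obtains x y where "e = edge x y" "x \<noteq> y" "x < N" "y < N"
  using assms that[of "fst e" "snd e"] by (auto simp: pairs_def edge_def min_def max_def)

lemma finite_pairs: "finite (pairs N)"
  by (rule finite_subset[of _ "{..<N} \<times> {..<N}"]) (auto simp: pairs_def)

lemma rel_edge: "(\<rho> (fst (edge i v)) = \<rho> (snd (edge i v))) \<longleftrightarrow> \<rho> i = \<rho> v"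
  by (auto simp: edge_def min_def max_def)

lemma balanced_swap:
  assumes "balanced K n \<sigma>" "i < K * n" "j < K * n"
  shows "balanced K n (\<sigma>(i := \<sigma> j, j := \<sigma> i))"
proof -
  let ?s = "\<lambda>v. if v = i then j else if v = j then i else v"
  have "card {v. v < K * n \<and> (\<sigma>(i := \<sigma> j, j := \<sigma> i)) v = k} = card {v. v < K * n \<and> \<sigma> v = k}" for k
    by (intro bij_betw_same_card[of ?s] bij_betw_byWitness[where f' = ?s]) (use assms in auto)
  then show ?thesis
    using assms by (auto simp: balanced_def)
qed

text \<open>Exchanging \<open>i\<close> and \<open>j\<close> changes only the factors of edges from
  \<open>i\<close> or \<open>j\<close> to other vertices of \<open>A \<union> B\<close>. Edges into
  \<open>HA \<union> HB\<close> cancel by colour 0, and the remaining change of log-likelihood is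
  the sum of the slacks in \<open>bad_i\<close> and \<open>bad_j\<close>. The colour of the edge
  between \<open>i\<close> and \<open>j\<close> is left free: it joins different communities before
  and after.\<close>

lemma mle_fails_swap:
  fixes a b :: "nat \<Rightarrow> real" and \<sigma> :: "nat \<Rightarrow> nat" and L K n :: nat
  defines "X \<equiv> \<lambda>c. ln (wdist b L n c) - ln (wdist a L n c)"
  assumes bal: "balanced K n \<sigma>" and kl: "k < K" "l < K" "k \<noteq> l" and n: "2 \<le> n"
    and A: "A = {v. v < K * n \<and> \<sigma> v = k}" and B: "B = {v. v < K * n \<and> \<sigma> v = l}"
    and H: "HA \<subseteq> A" "HB \<subseteq> B" "i \<in> HA" "j \<in> HB"
    and pos: "\<And>c. c \<le> L \<Longrightarrow> wdist a L n c > 0" "\<And>c. c \<le> L \<Longrightarrow> wdist b L n c > 0"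
    and G: "G \<in> colorings L (K * n)"
    and zero: "\<And>v. v \<in> HA \<union> HB \<Longrightarrow> v \<notin> {i, j} \<Longrightarrow> G (edge i v) = 0 \<and> G (edge j v) = 0"
    and bad_i: "(\<Sum>v\<in>B - HB. X (G (edge i v))) \<le> (\<Sum>v\<in>A - HA. X (G (edge i v)))"
    and bad_j: "(\<Sum>v\<in>A - HA. X (G (edge j v))) \<le> (\<Sum>v\<in>B - HB. X (G (edge j v)))"
  shows "mle_fails a b L K n \<sigma> G"
proof -
  define \<tau> where "\<tau> = \<sigma>(i := \<sigma> j, j := \<sigma> i)"
  have i: "i < K * n" "\<sigma> i = k" and j: "j < K * n" "\<sigma> j = l" and ij: "i \<noteq> j"
    using H A B kl by auto
  have \<tau>: "\<tau> i = l" "\<tau> j = k" "\<And>v. v \<noteq> i \<Longrightarrow> v \<noteq> j \<Longrightarrow> \<tau> v = \<sigma> v"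
    using i j ij by (auto simp: \<tau>_def)
  have finA: "finite A" and finB: "finite B"
    by (simp_all add: A B)
  define g :: "(nat \<Rightarrow> nat) \<Rightarrow> nat \<times> nat \<Rightarrow> real" where "g = (\<lambda>\<rho> e. if \<rho> (fst e) = \<rho> (snd e) then wdist a L n (G e) else wdist b L n (G e))"
  define \<Delta> where "\<Delta> = (\<lambda>e. ln (g \<tau> e) - ln (g \<sigma> e))"
  have g_edge: "g \<rho> (edge x y) = (if \<rho> x = \<rho> y then wdist a L n (G (edge x y)) else wdist b L n (G (edge x y)))"
    for \<rho> :: "nat \<Rightarrow> nat" and x y
    by (simp add: g_def rel_edge)
  have g_pos: "g \<rho> e > 0" if "e \<in> pairs (K * n)" for \<rho> :: "nat \<Rightarrow> nat" and e
  proof -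
    have "G e \<le> L"
      using PiE_mem[OF G[unfolded colorings_def] that] by simp
    then show ?thesis
      unfolding g_def by (simp add: pos)
  qed
  define W where "W = (A - {i}) \<union> (B - {j})"
  define D where "D = edge i ` W \<union> edge j ` W"
  have W: "v \<in> W \<longleftrightarrow> v < K * n \<and> (\<sigma> v = k \<or> \<sigma> v = l) \<and> v \<noteq> i \<and> v \<noteq> j" for v
    using i j kl by (auto simp: W_def A B)
  have D_sub: "D \<subseteq> pairs (K * n)"
  proof -
    have "edge i v \<in> pairs (K * n)" "edge j v \<in> pairs (K * n)" if "v \<in> W" for v
      using that edge_in_pairs i(1) j(1) unfolding W by metis+
    then show ?thesis
      unfolding D_def by blast
  qed
  \<comment> \<open>Either \<open>y = j\<close>, or \<open>y\<close> lies in a third community; in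
    both cases the edge joins different communities under \<open>\<sigma>\<close> and under
    \<open>\<tau>\<close>.\<close>
  have out_i: "\<Delta> (edge i y) = 0" if "y < K * n" "y \<notin> W" "y \<noteq> i" for y
    using that i j kl ij \<tau> by (cases "y = j") (auto simp: \<Delta>_def g_edge W)
  have out_j: "\<Delta> (edge j y) = 0" if "y < K * n" "y \<notin> W" "y \<noteq> j" for y
    using that i j kl ij \<tau> by (cases "y = i") (auto simp: \<Delta>_def g_edge W)
  have out: "\<Delta> e = 0" if "e \<in> pairs (K * n) - D" for e
  proof -
    obtain x y where e: "e = edge x y" "x \<noteq> y" "x < K * n" "y < K * n"
      using pairs_edgeE \<open>e \<in> _\<close> by (metis DiffD1)
    have notW: "x \<in> {i, j} \<Longrightarrow> y \<notin> W" "y \<in> {i, j} \<Longrightarrow> x \<notin> W"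
      using \<open>e \<in> _\<close> e(1) edge_commute[of x y] unfolding D_def by blast+
    consider "x = i" | "x = j" | "y = i" | "y = j" | "x \<notin> {i, j}" "y \<notin> {i, j}"
      by blast
    then show ?thesis
    proof cases
      case 1 then show ?thesis using out_i e notW by auto
    next
      case 2 then show ?thesis using out_j e notW by auto
    next
      case 3 then show ?thesis using out_i[of x] e notW edge_commute[of x y] by auto
    next
      case 4 then show ?thesis using out_j[of x] e notW edge_commute[of x y] by auto
    next
      case 5 then show ?thesis using \<tau>(3) by (auto simp: \<Delta>_def g_edge e)
    qed
  qed
  define f where "f = (\<lambda>v. X (G (edge i v)) - X (G (edge j v)))"
  \<comment> \<open>For \<open>v\<close> in \<open>A\<close> the edge to \<open>i\<close> becomes an
    edge between communities and the edge to \<open>j\<close> becomes internal; for \<open>v\<close>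
    in \<open>B\<close> the reverse happens.\<close>
  have on_A: "\<Delta> (edge i v) + \<Delta> (edge j v) = f v" if "v \<in> A - {i}" for v
  proof -
    have "v \<noteq> j" "\<sigma> v = k"
      using that j(2) kl by (auto simp: A)
    moreover from this that have "\<tau> v = k"
      by (simp add: \<tau>)
    ultimately show ?thesis
      using kl by (simp add: \<Delta>_def g_edge f_def X_def i j \<tau>)
  qed
  have on_B: "\<Delta> (edge i v) + \<Delta> (edge j v) = - f v" if "v \<in> B - {j}" for v
  proof -
    have "v \<noteq> i" "\<sigma> v = l"
      using that i(2) kl by (auto simp: B)
    moreover from this that have "\<tau> v = l"
      by (simp add: \<tau>)
    ultimately show ?thesis
      using kl by (simp add: \<Delta>_def g_edge f_def X_def i j \<tau>)
  qed
  have not_W: "i \<notin> W" "j \<notin> W" and jA: "j \<notin> A" and iB: "i \<notin> B" and AB: "A \<inter> B = {}"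
    using i(2) j(2) kl by (auto simp: W A B)
  have f0: "f v = 0" if "v \<in> HA \<union> HB" "v \<notin> {i, j}" for v
    using zero[OF that] by (simp add: f_def)
  have "(\<Sum>e\<in>pairs (K * n). \<Delta> e) = (\<Sum>e\<in>D. \<Delta> e)"
    by (intro sum.mono_neutral_right finite_pairs D_sub ballI out)
  also have "\<dots> = (\<Sum>e\<in>edge i ` W. \<Delta> e) + (\<Sum>e\<in>edge j ` W. \<Delta> e)"
    unfolding D_def
  proof (rule sum.union_disjoint)
    show "edge i ` W \<inter> edge j ` W = {}"
      using edge_cross_neq[OF _ ij] not_W by fastforce
  qed (use finA finB in \<open>auto simp: W_def\<close>)
  also have "\<dots> = (\<Sum>v\<in>W. \<Delta> (edge i v) + \<Delta> (edge j v))"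
    by (simp add: sum.reindex inj_on_edge sum.distrib)
  also have "\<dots> = (\<Sum>v\<in>A - {i}. \<Delta> (edge i v) + \<Delta> (edge j v)) + (\<Sum>v\<in>B - {j}. \<Delta> (edge i v) + \<Delta> (edge j v))"
    unfolding W_def using finA finB AB by (intro sum.union_disjoint) auto
  also have "\<dots> = (\<Sum>v\<in>A - {i}. f v) + (\<Sum>v\<in>B - {j}. - f v)"
    using on_A on_B by simp
  \<comment> \<open>On \<open>HA\<close> both edges at \<open>v\<close> have colour 0, so the two
    values of \<open>X\<close> cancel.\<close>
  also have "(\<Sum>v\<in>A - {i}. f v) = (\<Sum>v\<in>A - HA. f v)"
    using f0 H finA jA by (intro sum.mono_neutral_right) auto
  also have "(\<Sum>v\<in>B - {j}. - f v) = (\<Sum>v\<in>B - HB. - f v)"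
    using f0 H finB iB by (intro sum.mono_neutral_right) auto
  also have "(\<Sum>v\<in>A - HA. f v) + (\<Sum>v\<in>B - HB. - f v) \<ge> 0"
    using bad_i bad_j by (simp add: f_def sum_subtractf sum_negf)
  finally have "0 \<le> (\<Sum>e\<in>pairs (K * n). ln (g \<tau> e)) - (\<Sum>e\<in>pairs (K * n). ln (g \<sigma> e))"
    by (simp add: \<Delta>_def sum_subtractf)
  moreover have lik: "lik a b L K n \<rho> G = (\<Prod>e\<in>pairs (K * n). g \<rho> e)" for \<rho>
    by (simp add: lik_def g_def)
  moreover have "(\<Sum>e\<in>pairs (K * n). ln (g \<rho> e)) = ln (lik a b L K n \<rho> G)" for \<rho>
    unfolding lik using g_pos finite_pairs by (intro ln_prod[symmetric]) (auto simp: less_le)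
  moreover have "lik a b L K n \<rho> G > 0" for \<rho>
    unfolding lik using g_pos by (intro prod_pos) auto
  ultimately have "lik a b L K n \<sigma> G \<le> lik a b L K n \<tau> G"
    by simp
  moreover have "balanced K n \<tau>"
    unfolding \<tau>_def by (rule balanced_swap[OF bal i(1) j(1)])
  \<comment> \<open>For communities of size 1 the swap could be a mere relabelling; since
    \<open>n\<close> is at least 2, some other vertex of \<open>A\<close> is separated from
    \<open>i\<close>.\<close>
  moreover have "\<not> same_partition K n \<sigma> \<tau>"
  proof -
    have "card A = n"
      using bal kl by (simp add: balanced_def A)
    then have "card (A - {i}) > 0"
      using n i finA by (simp add: A card_Diff_singleton_if)
    then obtain v where v: "v \<in> A" "v \<noteq> i"
      by (auto simp: card_gt_0_iff)
    then have "v < K * n" "\<sigma> v = k" "v \<noteq> j"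
      using A j kl by auto
    then show ?thesis
      using \<tau> v i kl unfolding same_partition_def by metis
  qed
  ultimately show ?thesis
    unfolding mle_fails_def by blast
qed

subsection \<open>Probability of bad vertices\<close>

text \<open>The edge sets from different vertices of \<open>I\<close> to \<open>A \<union> B\<close>
  are disjoint, so the events are independent. Each fails to occur with probability at most
  \<open>1 - P\<close>, and \<open>1 - P\<close> is at most \<open>exp (- P)\<close>. The second
  community is covered by exchanging \<open>A\<close> and \<open>B\<close>.\<close>

lemma expct_no_bad_vertex_le:
  fixes p q :: "'c \<Rightarrow> real"
  defines "X \<equiv> \<lambda>c. ln (q c) - ln (p c)"
    and "Z \<equiv> \<lambda>C. \<Sum>c\<in>C. sqrt (p c * q c)"
  assumes fin: "finite I" "finite A" "finite B" "finite E"
    and disj: "I \<inter> A = {}" "I \<inter> B = {}" "A \<inter> B = {}" and card: "card A = m" "card B = m"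
    and C: "finite C" "C \<noteq> {}" and pos: "\<And>c. c \<in> C \<Longrightarrow> p c > 0" "\<And>c. c \<in> C \<Longrightarrow> q c > 0"
    and sub: "\<And>i v. i \<in> I \<Longrightarrow> v \<in> A \<union> B \<Longrightarrow> edge i v \<in> E"
    and w1: "\<And>e. e \<in> E \<Longrightarrow> (\<Sum>c\<in>C. w e c) = 1"
    and w_nonneg: "\<And>e c. e \<in> E \<Longrightarrow> c \<in> C \<Longrightarrow> w e c \<ge> 0"
    and wA: "\<And>i v. i \<in> I \<Longrightarrow> v \<in> A \<Longrightarrow> w (edge i v) = p"
    and wB: "\<And>i v. i \<in> I \<Longrightarrow> v \<in> B \<Longrightarrow> w (edge i v) = q"
    and t: "t > 0" and moment: "2 * real m * (\<Sum>c\<in>C. sqrt (p c * q c) * (X c)\<^sup>2) \<le> 4 * t\<^sup>2 * Z C"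
  shows "expct E C w (\<lambda>G. \<Prod>i\<in>I. of_bool (\<not> (\<Sum>v\<in>B. X (G (edge i v))) \<le> (\<Sum>v\<in>A. X (G (edge i v)))))
    \<le> exp (- (real (card I) * (exp (- t) * Z C ^ (2 * m) / 2)))"
proof -
  define P where "P = exp (- t) * Z C ^ (2 * m) / 2"
  define Ei where "Ei = (\<lambda>i. edge i ` A \<union> edge i ` B)"
  define bad where "bad = (\<lambda>i G. (\<Sum>v\<in>B. X (G (edge i v))) \<le> (\<Sum>v\<in>A. X (G (edge i v))))"
  define F :: "nat \<Rightarrow> (nat \<times> nat \<Rightarrow> 'c) \<Rightarrow> real" where "F = (\<lambda>i G. of_bool (\<not> bad i G))"
  have Ei_sub: "Ei i \<subseteq> E" if "i \<in> I" for i
    using sub that by (auto simp: Ei_def)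
  have bad_cong: "bad i G \<longleftrightarrow> bad i G'" if "\<forall>e\<in>Ei i. G e = G' e" for i G G'
  proof -
    have "(\<Sum>v\<in>B. X (G (edge i v))) = (\<Sum>v\<in>B. X (G' (edge i v)))"
      using that by (intro sum.cong) (auto simp: Ei_def)
    moreover have "(\<Sum>v\<in>A. X (G (edge i v))) = (\<Sum>v\<in>A. X (G' (edge i v)))"
      using that by (intro sum.cong) (auto simp: Ei_def)
    ultimately show ?thesis
      by (simp add: bad_def)
  qed
  have dep: "depends_on (Ei i) (F i)" for i
    unfolding depends_on_def
  proof (intro allI impI)
    fix G G' :: "nat \<times> nat \<Rightarrow> 'c" assume "\<forall>e\<in>Ei i. G e = G' e"
    then have "bad i G = bad i G'"
      by (rule bad_cong)
    then show "F i G = F i G'"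
      by (simp add: F_def)
  qed
  have fin_Ei: "finite (Ei i)" for i
    using fin by (simp add: Ei_def)
  have disj_Ei: "Ei i \<inter> Ei j = {}" if "i \<in> I" "j \<in> I" "i \<noteq> j" for i j
  proof -
    have "edge i v \<noteq> edge j v'" if "v' \<in> A \<union> B" for v v'
      using edge_cross_neq[of i v' j v] that \<open>i \<in> I\<close> \<open>i \<noteq> j\<close> disj by blast
    then show ?thesis
      unfolding Ei_def by blast
  qed
  have P_le: "P \<le> expct (Ei i) C w (\<lambda>G. of_bool (bad i G))" if "i \<in> I" for i
  proof -
    have sums: "(\<Sum>v\<in>W. X (G (edge i v))) = (\<Sum>e\<in>edge i ` W. X (G e))" for G W
      by (simp add: sum.reindex inj_on_edge)
    have "edge i ` A \<inter> edge i ` B = {}"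
      using disj(3) by (auto simp: edge_inject)
    then show ?thesis
      unfolding P_def bad_def sums Ei_def Z_def unfolding X_def
      using fin card C pos wA wB that t moment
      by (intro llr_nonneg_lower_bound) (auto simp: card_image inj_on_edge X_def Z_def)
  qed
  have F_le: "expct (Ei i) C w (F i) \<le> 1 - P" if "i \<in> I" for i
  proof -
    have "expct (Ei i) C w (F i) = expct (Ei i) C w (\<lambda>G. 1 - of_bool (bad i G))"
      unfolding F_def by (intro expct_cong) auto
    also have "\<dots> = expct (Ei i) C w (\<lambda>_. 1) - expct (Ei i) C w (\<lambda>G. of_bool (bad i G))"
      by (rule expct_diff)
    also have "expct (Ei i) C w (\<lambda>_. 1) = (\<Prod>e\<in>Ei i. \<Sum>c\<in>C. w e c)"
      using fin_Ei C by (simp add: expct_const)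
    also have "\<dots> = 1"
      using w1 Ei_sub[OF that] by (intro prod.neutral) blast
    finally show ?thesis
      using P_le[OF that] by simp
  qed
  \<comment> \<open>The edges of \<open>E\<close> that touch no event are integrated out before the
    product is factorised.\<close>
  have "expct E C w (\<lambda>G. \<Prod>i\<in>I. F i G) = expct (\<Union>i\<in>I. Ei i) C w (\<lambda>G. \<Prod>i\<in>I. F i G)"
  proof (rule expct_marginal)
    show "depends_on (\<Union>i\<in>I. Ei i) (\<lambda>G. \<Prod>i\<in>I. F i G)"
      unfolding depends_on_def
    proof (intro allI impI prod.cong refl)
      fix G G' :: "nat \<times> nat \<Rightarrow> 'c" and i assume "\<forall>e\<in>\<Union> (Ei ` I). G e = G' e" "i \<in> I"
      then show "F i G = F i G'"
        using depends_onD[OF dep[of i], of G G'] by blast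
    qed
  qed (use fin C w1 Ei_sub in auto)
  also have "\<dots> = (\<Prod>i\<in>I. expct (Ei i) C w (F i))"
    by (intro expct_prod_indep fin fin_Ei disj_Ei dep)
  also have "\<dots> \<le> (\<Prod>i\<in>I. exp (- P))"
  proof (intro prod_mono conjI)
    fix i assume i: "i \<in> I"
    have "expct (Ei i) C w (\<lambda>_. 0) \<le> expct (Ei i) C w (F i)"
      using w_nonneg Ei_sub[OF i] by (intro expct_mono) (auto simp: F_def)
    then show "0 \<le> expct (Ei i) C w (F i)"
      using expct_mult_left[of "Ei i" C w 0] by simp
    show "expct (Ei i) C w (F i) \<le> exp (- P)"
      using F_le[OF i] exp_ge_add_one_self[of "- P"] by simp
  qed
  also have "\<dots> = exp (- (real (card I) * P))"
    by (simp add: exp_of_nat_mult[symmetric])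
  finally show ?thesis
    by (simp add: P_def F_def bad_def)
qed

section \<open>The block model as a product measure\<close>

lemma sum_wdist: "(\<Sum>l\<in>{0..L}. wdist c L n l) = 1"
proof -
  have "(\<Sum>l\<in>{Suc 0..L}. wdist c L n l) = (\<Sum>l=1..L. c l * ln (real n) / real n)"
    by (intro sum.cong) (auto simp: wdist_def)
  then show ?thesis
    by (simp add: sum.atLeast_Suc_atMost wdist_def sum_distrib_right sum_divide_distrib)
qed

text \<open>The likelihood of the true assignment is itself the sampling density, with the weight of
  an edge determined by whether \<open>\<sigma>\<close> agrees at its ends.\<close>

lemma wsbm_prob_eq_expct:
  "wsbm_prob a b L K n \<sigma> Q = expct (pairs (K * n)) {0..L}
     (\<lambda>e. if \<sigma> (fst e) = \<sigma> (snd e) then wdist a L n else wdist b L n) (\<lambda>G. of_bool (Q G))"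
proof -
  have "finite (colorings L (K * n))"
    by (simp add: colorings_def finite_PiE finite_pairs)
  then have "wsbm_prob a b L K n \<sigma> Q = (\<Sum>G\<in>colorings L (K * n). lik a b L K n \<sigma> G * of_bool (Q G))"
    unfolding wsbm_prob_def by (simp add: of_bool_def sum.inter_filter if_distrib cong: if_cong)
  also have "\<dots> = expct (pairs (K * n)) {0..L}
     (\<lambda>e. if \<sigma> (fst e) = \<sigma> (snd e) then wdist a L n else wdist b L n) (\<lambda>G. of_bool (Q G))"
    unfolding expct_def colorings_def lik_def
    by (intro sum.cong refl arg_cong2[where f = "(*)"] prod.cong) auto
  finally show ?thesis .
qed

text \<open>Union bound: each coordinate in \<open>D\<close> differs from \<open>c0\<close> with
  probability at most \<open>\<delta>\<close>.\<close>

lemma expct_all_eq_ge: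
  assumes "finite E" "finite C" "D \<subseteq> E" "c0 \<in> C"
    and "\<And>e. e \<in> E \<Longrightarrow> (\<Sum>c\<in>C. w e c) = 1" "\<And>e c. e \<in> E \<Longrightarrow> c \<in> C \<Longrightarrow> w e c \<ge> 0"
    and "\<And>e. e \<in> D \<Longrightarrow> w e c0 \<ge> 1 - \<delta>"
  shows "expct E C w (\<lambda>G. of_bool (\<forall>e\<in>D. G e = c0)) \<ge> 1 - real (card D) * \<delta>"
proof -
  have finD: "finite D"
    using assms(1,3) finite_subset by blast
  have single: "expct E C w (\<lambda>G. of_bool (G e \<noteq> c0)) \<le> \<delta>" if "e \<in> D" for e
  proof -
    have "expct E C w (\<lambda>G. of_bool (G e \<noteq> c0)) = expct {e} C w (\<lambda>G. of_bool (G e \<noteq> c0))"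
      using that assms by (intro expct_marginal) (auto simp: depends_on_def)
    also have "\<dots> = (\<Sum>c\<in>C. w e c * of_bool (c \<noteq> c0))"
      using assms(2) by (subst expct_singleton) (auto simp: depends_on_def)
    also have "\<dots> = (\<Sum>c\<in>C - {c0}. w e c)"
      by (intro sum.mono_neutral_cong_right) (use assms(2) in auto)
    also have "\<dots> = 1 - w e c0"
      using assms(5)[of e] that assms(3) by (subst sum_diff1) (auto simp: assms(2,4))
    finally show ?thesis
      using assms(7)[OF that] by simp
  qed
  have "1 - real (card D) * \<delta> \<le> 1 - (\<Sum>e\<in>D. expct E C w (\<lambda>G. of_bool (G e \<noteq> c0)))"
    using sum_bounded_above[of D "\<lambda>e. expct E C w (\<lambda>G. of_bool (G e \<noteq> c0))" \<delta>] single by simp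
  also have "\<dots> = expct E C w (\<lambda>G. 1 - (\<Sum>e\<in>D. of_bool (G e \<noteq> c0)))"
    using assms(1,2,5) by (simp add: expct_diff expct_sum expct_const)
  also have "\<dots> \<le> expct E C w (\<lambda>G. of_bool (\<forall>e\<in>D. G e = c0))"
  proof (intro expct_mono assms)
    fix G :: "'a \<Rightarrow> 'b"
    show "1 - (\<Sum>e\<in>D. of_bool (G e \<noteq> c0)) \<le> (of_bool (\<forall>e\<in>D. G e = c0) :: real)"
    proof (cases "\<forall>e\<in>D. G e = c0")
      case False
      then obtain e where "e \<in> D" "G e \<noteq> c0"
        by blast
      then have "(1 :: real) \<le> (\<Sum>e\<in>D. of_bool (G e \<noteq> c0))"
        using member_le_sum[of e D "\<lambda>e. of_bool (G e \<noteq> c0) :: real"] finD by simp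
      with False show ?thesis
        by simp
    qed simp
  qed
  finally show ?thesis .
qed

section \<open>Failure probability for fixed n\<close>

text \<open>By \<open>many\<close>, each of \<open>HA\<close> and \<open>HB\<close> lacks a bad
  vertex with probability at most \<open>exp (- 2)\<close>, hence at most 1/4. Given a bad pair, the
  at most \<open>4 * h\<close> relevant inner edges all have colour 0 with probability at least 2/3.
  Together this gives 1/2 times 2/3.\<close>

lemma wsbm_prob_mle_fails_ge:
  fixes a b :: "nat \<Rightarrow> real" and \<sigma> :: "nat \<Rightarrow> nat" and L K n h :: nat
  defines "X \<equiv> \<lambda>c. ln (wdist b L n c) - ln (wdist a L n c)"
    and "Z \<equiv> \<Sum>c\<in>{0..L}. sqrt (wdist a L n c * wdist b L n c)"
  assumes bal: "balanced K n \<sigma>" and kl: "k < K" "l < K" "k \<noteq> l" and n: "2 \<le> n" and h: "h \<le> n"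
    and pos: "\<And>c. c \<le> L \<Longrightarrow> wdist a L n c > 0" "\<And>c. c \<le> L \<Longrightarrow> wdist b L n c > 0"
    and \<delta>: "wdist a L n 0 \<ge> 1 - \<delta>" "wdist b L n 0 \<ge> 1 - \<delta>" "0 \<le> \<delta>" "4 * real h * \<delta> \<le> 1 / 3"
    and t: "t > 0"
    and moment: "2 * real (n - h) * (\<Sum>c\<in>{0..L}. sqrt (wdist a L n c * wdist b L n c) * (X c)\<^sup>2) \<le> 4 * t\<^sup>2 * Z"
    and many: "2 \<le> real h * (exp (- t) * Z ^ (2 * (n - h)) / 2)"
  shows "wsbm_prob a b L K n \<sigma> (mle_fails a b L K n \<sigma>) \<ge> 1 / 3"
proof -
  define C where "C = {0..L}"
  define w where "w = (\<lambda>e. if \<sigma> (fst e) = \<sigma> (snd e) then wdist a L n else wdist b L n)"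
  define A where "A = {v. v < K * n \<and> \<sigma> v = k}"
  define B where "B = {v. v < K * n \<and> \<sigma> v = l}"
  have finAB: "finite A" "finite B" and AB: "A \<inter> B = {}"
    using kl by (auto simp: A_def B_def)
  have cardAB: "card A = n" "card B = n"
    using bal kl by (simp_all add: balanced_def A_def B_def)
  obtain HA where HA: "HA \<subseteq> A" "card HA = h" "finite HA"
    using obtain_subset_with_card_n[of h A] cardAB h by auto
  obtain HB where HB: "HB \<subseteq> B" "card HB = h" "finite HB"
    using obtain_subset_with_card_n[of h B] cardAB h by auto
  define H where "H = HA \<union> HB"
  \<comment> \<open>Badness only looks at edges leaving \<open>H\<close>, which lie in
    \<open>E1\<close>; thus a bad pair can be chosen from \<open>E1\<close> before the colours on
    \<open>E2\<close> are revealed.\<close>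
  define E2 where "E2 = {e \<in> pairs (K * n). fst e \<in> H \<and> snd e \<in> H}"
  define E1 where "E1 = pairs (K * n) - E2"
  have E12: "pairs (K * n) = E1 \<union> E2" "E1 \<inter> E2 = {}" "finite E1" "finite E2"
    using finite_pairs by (auto simp: E1_def E2_def)
  have C: "finite C" "C \<noteq> {}"
    by (auto simp: C_def)
  have w1: "(\<Sum>c\<in>C. w e c) = 1" for e
    by (simp add: w_def C_def sum_wdist)
  have w_nonneg: "w e c \<ge> 0" if "c \<in> C" for e c
    using that pos[of c] by (auto simp: w_def C_def)
  have w_edge: "w (edge x y) = (if \<sigma> x = \<sigma> y then wdist a L n else wdist b L n)" for x y
    by (simp add: w_def rel_edge)
  define badA where "badA = (\<lambda>i G. (\<Sum>v\<in>B - HB. X (G (edge i v))) \<le> (\<Sum>v\<in>A - HA. X (G (edge i v))))"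
  define badB where "badB = (\<lambda>j G. (\<Sum>v\<in>A - HA. X (G (edge j v))) \<le> (\<Sum>v\<in>B - HB. X (G (edge j v))))"
  define noA :: "(nat \<times> nat \<Rightarrow> nat) \<Rightarrow> real" where "noA = (\<lambda>G. \<Prod>i\<in>HA. of_bool (\<not> badA i G))"
  define noB :: "(nat \<times> nat \<Rightarrow> nat) \<Rightarrow> real" where "noB = (\<lambda>G. \<Prod>j\<in>HB. of_bool (\<not> badB j G))"
  have out: "edge i v \<in> E1" if "i \<in> H" "v \<in> (A - HA) \<union> (B - HB)" for i v
  proof -
    have "v \<notin> H" "v < K * n" "i < K * n"
      using that HA HB AB by (auto simp: H_def A_def B_def)
    moreover have "i \<noteq> v"
      using that(1) \<open>v \<notin> H\<close> by auto
    ultimately show ?thesis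
      by (auto simp: E1_def E2_def edge_in_pairs) (auto simp: edge_def min_def max_def split: if_splits)
  qed
  have exp_2: "exp (- 2) \<le> (1 / 4 :: real)"
  proof -
    have "2 * 2 \<le> exp 1 * (exp 1 :: real)"
      using exp_ge_add_one_self[of 1] by (intro mult_mono) auto
    then show ?thesis
      by (simp add: exp_minus field_simps flip: exp_add)
  qed
  have card_diff: "card (A - HA) = n - h" "card (B - HB) = n - h"
    using HA HB cardAB by (simp_all add: card_Diff_subset)
  have noA_le: "expct E1 C w noA \<le> 1 / 4"
  proof -
    have "expct E1 C w noA \<le> exp (- (real (card HA) * (exp (- t) * Z ^ (2 * (n - h)) / 2)))"
      unfolding noA_def badA_def X_def Z_def C_def[symmetric]
      by (rule expct_no_bad_vertex_le[where E = E1])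
        (use HA HB finAB AB card_diff C E12 w1 w_nonneg pos t moment kl out in
          \<open>auto simp: w_edge X_def Z_def C_def H_def A_def B_def\<close>)
    also have "\<dots> \<le> exp (- 2)"
      using many HA by simp
    finally show ?thesis
      using exp_2 by simp
  qed
  have noB_le: "expct E1 C w noB \<le> 1 / 4"
  proof -
    have "expct E1 C w noB \<le> exp (- (real (card HB) * (exp (- t) * Z ^ (2 * (n - h)) / 2)))"
      unfolding noB_def badB_def X_def Z_def C_def[symmetric]
      by (rule expct_no_bad_vertex_le[where E = E1])
        (use HA HB finAB AB card_diff C E12 w1 w_nonneg pos t moment kl out in
          \<open>auto simp: w_edge X_def Z_def C_def H_def A_def B_def\<close>)
    also have "\<dots> \<le> exp (- 2)"
      using many HB by simp
    finally show ?thesis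
      using exp_2 by simp
  qed
  define merge :: "(nat \<times> nat \<Rightarrow> nat) \<Rightarrow> (nat \<times> nat \<Rightarrow> nat) \<Rightarrow> nat \<times> nat \<Rightarrow> nat"
    where "merge = (\<lambda>G1 G2 e. if e \<in> E1 then G1 e else G2 e)"
  have merge_col: "merge G1 G2 \<in> colorings L (K * n)"
    if "G1 \<in> E1 \<rightarrow>\<^sub>E C" "G2 \<in> E2 \<rightarrow>\<^sub>E C" for G1 G2
    unfolding colorings_def C_def[symmetric]
  proof (rule PiE_I)
    fix e assume "e \<in> pairs (K * n)"
    then show "merge G1 G2 e \<in> C"
      using PiE_mem[OF that(1), of e] PiE_mem[OF that(2), of e] by (auto simp: E12(1) merge_def)
  next
    fix e assume "e \<notin> pairs (K * n)"
    then show "merge G1 G2 e = undefined"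
      using PiE_arb[OF that(2), of e] by (simp add: E12(1) merge_def)
  qed
  have swap: "mle_fails a b L K n \<sigma> (merge G1 G2)"
    if G: "G1 \<in> E1 \<rightarrow>\<^sub>E C" "G2 \<in> E2 \<rightarrow>\<^sub>E C" and ij: "i \<in> HA" "j \<in> HB" "badA i G1" "badB j G1"
      and zero: "\<And>e. e \<in> E2 \<inter> (edge i ` H \<union> edge j ` H) \<Longrightarrow> G2 e = 0" for G1 G2 i j
  proof (rule mle_fails_swap[OF bal kl n A_def B_def HA(1) HB(1) ij(1,2) pos merge_col[OF G]])
    have ijH: "i \<in> H" "j \<in> H"
      using ij by (auto simp: H_def)
    have merge_out: "merge G1 G2 (edge x v) = G1 (edge x v)" if "x \<in> H" "v \<in> (A - HA) \<union> (B - HB)" for x v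
      using out[OF that] by (simp add: merge_def)
    show "(\<Sum>v\<in>B - HB. ln (wdist b L n (merge G1 G2 (edge i v))) - ln (wdist a L n (merge G1 G2 (edge i v))))
       \<le> (\<Sum>v\<in>A - HA. ln (wdist b L n (merge G1 G2 (edge i v))) - ln (wdist a L n (merge G1 G2 (edge i v))))"
      using ij(3) by (simp add: badA_def X_def merge_out ijH)
    show "(\<Sum>v\<in>A - HA. ln (wdist b L n (merge G1 G2 (edge j v))) - ln (wdist a L n (merge G1 G2 (edge j v))))
       \<le> (\<Sum>v\<in>B - HB. ln (wdist b L n (merge G1 G2 (edge j v))) - ln (wdist a L n (merge G1 G2 (edge j v))))"
      using ij(4) by (simp add: badB_def X_def merge_out ijH)
    fix v assume v: "v \<in> HA \<union> HB" "v \<notin> {i, j}"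
    have "edge x v \<in> E2" if "x \<in> H" "x \<noteq> v" for x
    proof -
      have "x < K * n" "v < K * n" "v \<in> H"
        using that v HA HB by (auto simp: H_def A_def B_def)
      then show ?thesis
        using that edge_in_pairs[of x "K * n" v] by (auto simp: E2_def edge_def min_def max_def)
    qed
    then have "edge i v \<in> E2" "edge j v \<in> E2"
      using ijH v by auto
    moreover from this have "edge i v \<notin> E1" "edge j v \<notin> E1"
      using E12(2) by auto
    ultimately show "merge G1 G2 (edge i v) = 0 \<and> merge G1 G2 (edge j v) = 0"
      using v zero by (auto simp: merge_def H_def)
  qed
  \<comment> \<open>Conditional bound given \<open>G1\<close>: the left factor is 1 if both kinds of
    bad vertex exist and at most 0 otherwise, so it is a lower bound for the indicator of a bad
    pair.\<close>
  have inner: "(1 - noA G1 - noB G1) * (2 / 3) \<le>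
      expct E2 C w (\<lambda>G2. of_bool (mle_fails a b L K n \<sigma> (merge G1 G2)))" (is "_ \<le> ?R")
    if G1: "G1 \<in> E1 \<rightarrow>\<^sub>E C" for G1
  proof -
    have no01: "0 \<le> noA G1" "0 \<le> noB G1"
      by (auto simp: noA_def noB_def intro!: prod_nonneg)
    have "expct E2 C w (\<lambda>_. 0) \<le> ?R"
      using w_nonneg by (intro expct_mono) auto
    then have R: "0 \<le> ?R"
      using expct_mult_left[of E2 C w 0] by simp
    show ?thesis
    proof (cases "(\<exists>i\<in>HA. badA i G1) \<and> (\<exists>j\<in>HB. badB j G1)")
      case True
      then obtain i j where ij: "i \<in> HA" "j \<in> HB" "badA i G1" "badB j G1"
        by blast
      \<comment> \<open>Intersecting with \<open>E2\<close> removes the degenerate pairs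
        \<open>edge i i\<close> and \<open>edge j j\<close>. Each of the two images has at most
        \<open>2 * h\<close> elements.\<close>
      define D where "D = E2 \<inter> (edge i ` H \<union> edge j ` H)"
      have "card D \<le> card (edge i ` H \<union> edge j ` H)"
        unfolding D_def using HA HB by (intro card_mono) (auto simp: H_def)
      also have "\<dots> \<le> card H + card H"
        by (rule order_trans[OF card_Un_le]) (simp add: card_image inj_on_edge)
      also have "card H \<le> 2 * h"
        unfolding H_def using card_Un_le[of HA HB] HA HB by simp
      finally have "real (card D) \<le> 4 * real h"
        by simp
      then have "real (card D) * \<delta> \<le> 1 / 3"
        using \<delta>(3,4) mult_right_mono[of "real (card D)" "4 * real h" \<delta>] by linarith
      then have "2 / 3 \<le> 1 - real (card D) * \<delta>"
        by simp
      also have "\<dots> \<le> expct E2 C w (\<lambda>G2. of_bool (\<forall>e\<in>D. G2 e = 0))"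
        using E12 C w1 w_nonneg \<delta> by (intro expct_all_eq_ge) (auto simp: D_def C_def w_def)
      also have "\<dots> \<le> ?R"
        using swap[OF G1 _ ij] w_nonneg by (intro expct_mono) (auto simp: D_def)
      finally have "2 / 3 \<le> ?R" .
      moreover have "(1 - noA G1 - noB G1) * (2 / 3) \<le> 2 / 3"
        using no01 by simp
      ultimately show ?thesis
        by linarith
    next
      case False
      then have "noA G1 = 1 \<or> noB G1 = 1"
        by (auto simp: noA_def noB_def intro!: prod.neutral)
      then have "(1 - noA G1 - noB G1) * (2 / 3) \<le> 0"
        using no01 by auto
      with R show ?thesis
        by linarith
    qed
  qed
  have "1 / 3 \<le> (1 - expct E1 C w noA - expct E1 C w noB) * (2 / 3)"
    using noA_le noB_le by (simp add: field_simps)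
  also have "1 - expct E1 C w noA - expct E1 C w noB = expct E1 C w (\<lambda>G. 1 - noA G - noB G)"
    using E12(3) C(1) w1 by (simp add: expct_diff expct_const)
  also have "\<dots> * (2 / 3) = expct E1 C w (\<lambda>G1. (1 - noA G1 - noB G1) * (2 / 3))"
    by (rule expct_mult_right[symmetric])
  also have "\<dots> \<le> expct E1 C w (\<lambda>G1. expct E2 C w (\<lambda>G2. of_bool (mle_fails a b L K n \<sigma> (merge G1 G2))))"
    using inner w_nonneg by (intro expct_mono) auto
  also have "\<dots> = wsbm_prob a b L K n \<sigma> (mle_fails a b L K n \<sigma>)"
    unfolding wsbm_prob_eq_expct E12(1) C_def[symmetric] w_def[symmetric] merge_def
    by (rule expct_union[symmetric]) (use E12 in auto)
  finally show ?thesis .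
qed

subsection \<open>Asymptotics\<close>

text \<open>To first order in \<open>x\<close> the square root is
  \<open>1 - (u + v) / 2 * x\<close>. The extra slope \<open>\<eta>\<close> absorbs the quadratic
  error once \<open>x\<close> is small, as comparison of squares shows. With \<open>s\<close> the
  sum of the \<open>sqrt (a l * b l)\<close>, the quantity \<open>u + v - 2 * s\<close> becomes the
  exponent \<open>I\<close>.\<close>

lemma hellinger_affinity_ge:
  fixes u v s \<eta> x :: real
  assumes "0 < u" "0 < v" "0 < \<eta>" "0 \<le> x"
    and "((u + v) / 2 + \<eta>) * x \<le> 1" "((u + v) / 2 + \<eta>)\<^sup>2 * x \<le> 2 * \<eta>"
  shows "1 - ((u + v - 2 * s) / 2 + \<eta>) * x \<le> sqrt ((1 - u * x) * (1 - v * x)) + s * x"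
proof -
  define \<mu> where "\<mu> = (u + v) / 2 + \<eta>"
  have "(1 - \<mu> * x)\<^sup>2 = 1 - (u + v) * x + (\<mu>\<^sup>2 * x - 2 * \<eta>) * x"
    by (simp add: \<mu>_def power2_eq_square field_simps)
  also have "\<dots> \<le> 1 - (u + v) * x + u * v * x * x"
  proof -
    have "(\<mu>\<^sup>2 * x - 2 * \<eta>) * x \<le> 0"
      using assms by (intro mult_nonpos_nonneg) (auto simp: \<mu>_def)
    moreover have "0 \<le> u * v * x * x"
      using assms by simp
    ultimately show ?thesis
      by linarith
  qed
  also have "\<dots> = (1 - u * x) * (1 - v * x)"
    by (simp add: algebra_simps)
  finally have "1 - \<mu> * x \<le> sqrt ((1 - u * x) * (1 - v * x))"
    by (rule real_le_rsqrt)
  then show ?thesis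
    by (simp add: \<mu>_def field_simps)
qed

theorem theorem4:
  fixes L K :: nat and a b :: "nat \<Rightarrow> real"
  assumes "L \<ge> 1"
    and "\<forall>l\<in>{1..L}. a l > 0 \<and> b l > 0"
    and "(\<Sum>l=1..L. (sqrt (a l) - sqrt (b l))^2) < 1"
    and "K \<ge> 2"
  shows "eventually (\<lambda>n. \<forall>\<sigma>. balanced K n \<sigma> \<longrightarrow>
            wsbm_prob a b L K n \<sigma> (mle_fails a b L K n \<sigma>) \<ge> 1/3) sequentially"
proof -
  define u where "u = (\<Sum>l=1..L. a l)"
  define v where "v = (\<Sum>l=1..L. b l)"
  define s where "s = (\<Sum>l=1..L. sqrt (a l * b l))"
  \<comment> \<open>The summand 1 keeps \<open>V\<close> positive even when \<open>a\<close> and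
    \<open>b\<close> coincide.\<close>
  define V where "V = (\<Sum>l=1..L. sqrt (a l * b l) * (ln (b l) - ln (a l))\<^sup>2) + 1"
  define I where "I = (\<Sum>l=1..L. (sqrt (a l) - sqrt (b l))\<^sup>2)"
  \<comment> \<open>The slack \<open>1 - I\<close> is \<open>8 * \<eta>\<close>. Of this,
    \<open>2 * \<eta>\<close> goes into \<open>2 * lam\<close>, one \<open>\<eta>\<close> into the
    expansion of \<open>ln (1 - lam * x)\<close> and one into \<open>t\<close>; the remaining
    \<open>4 * \<eta>\<close> has to beat the logarithm in \<open>h\<close>.\<close>
  define \<eta> where "\<eta> = (1 - I) / 8"
  define lam where "lam = I / 2 + \<eta>"
  have ab: "a l > 0" "b l > 0" if "1 \<le> l" "l \<le> L" for l
    using assms(2) that by auto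
  have uv: "u > 0" "v > 0"
    unfolding u_def v_def using assms(1) ab by (auto intro!: sum_pos)
  have s_nonneg: "s \<ge> 0"
    unfolding s_def using ab by (intro sum_nonneg) (auto simp: less_imp_le)
  have V: "V > 0"
    unfolding V_def using ab by (intro add_nonneg_pos sum_nonneg) (auto simp: less_imp_le)
  have I_eq: "I = u + v - 2 * s"
  proof -
    have "I = (\<Sum>l=1..L. a l + b l - 2 * sqrt (a l * b l))"
      unfolding I_def using ab
      by (intro sum.cong) (auto simp: power2_diff real_sqrt_mult less_imp_le)
    then show ?thesis
      by (simp add: u_def v_def s_def sum.distrib sum_subtractf sum_distrib_left)
  qed
  have I: "0 \<le> I" "I < 1"
    using assms(3) by (auto simp: I_def intro!: sum_nonneg)
  have \<eta>: "0 < \<eta>" "\<eta> < 1"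
    using I by (auto simp: \<eta>_def)
  have lam: "0 < lam" "2 * lam + 2 * \<eta> \<le> 1 - 4 * \<eta>"
    using I \<eta> by (simp_all add: lam_def) (simp add: \<eta>_def field_simps)
  define \<mu> where "\<mu> = (u + v) / 2 + \<eta>"
  have "0 < \<mu>"
    unfolding \<mu>_def using uv \<eta> by (intro add_pos_pos) auto
  then have \<mu>: "0 < \<mu>" "0 < \<mu>\<^sup>2"
    by simp_all
  have c: "u + v > 0"
    using uv by simp
  have "eventually (\<lambda>n::nat. n \<ge> 3) sequentially"
    by (rule eventually_ge_at_top)
  moreover have "eventually (\<lambda>n::nat. u * (ln n / n) < 1) sequentially"
    using uv by real_asymp
  moreover have "eventually (\<lambda>n::nat. v * (ln n / n) < 1) sequentially"
    using uv by real_asymp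
  moreover have "eventually (\<lambda>n::nat. \<mu> * (ln n / n) < 1) sequentially"
    using \<mu> by real_asymp
  moreover have "eventually (\<lambda>n::nat. lam * (ln n / n) < 1) sequentially"
    using lam(1) by real_asymp
  moreover have "eventually (\<lambda>n::nat. \<mu>\<^sup>2 * (ln n / n) < 2 * \<eta>) sequentially"
    using \<mu>(2) \<eta> by real_asymp
  \<comment> \<open>The left side is of order \<open>ln n\<close>: the squared logarithms of colour
    0 are of order \<open>(ln n / n)\<^sup>2\<close> and the other colours give
    \<open>V * (ln n / n)\<close>. A deviation \<open>\<eta> * ln n\<close> therefore dominates the
    standard deviation.\<close>
  moreover have "eventually (\<lambda>n::nat. 2 * n * ((- ln (1 - u * (ln n / n)) - ln (1 - v * (ln n / n)))\<^sup>2
      + V * (ln n / n)) \<le> 4 * (\<eta> * ln n)\<^sup>2 * (1 - lam * (ln n / n))) sequentially"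
    using uv V \<eta>(1) lam(1) by real_asymp
  moreover have "eventually (\<lambda>n::nat. - (2 * lam + \<eta>) * ln n \<le> 2 * real n * ln (1 - lam * (ln n / n))) sequentially"
    using \<eta>(1) lam(1) by real_asymp
  moreover have "eventually (\<lambda>n::nat. 2 \<le> n powr (4 * \<eta>) / (24 * (u + v) * ln n) - 1) sequentially"
    using \<eta>(1) c by real_asymp
  moreover have "eventually (\<lambda>n::nat. 12 * (u + v) * ln n \<ge> 1) sequentially"
    using c by real_asymp
  ultimately show ?thesis
  proof (eventually_elim, intro allI impI, goal_cases)
    case (1 n \<sigma>)
    note big = 1
    define x where "x = ln (real n) / real n"
    \<comment> \<open>Chosen so that \<open>h \<le> n / c\<close> gives
      \<open>4 * h * (u + v) * x \<le> 1 / 3\<close>, the bound for nonzero colours at the swapped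
      pair.\<close>
    define c where "c = 12 * (u + v) * ln (real n)"
    define h where "h = nat \<lfloor>real n / c\<rfloor>"
    define t where "t = \<eta> * ln (real n)"
    define p where "p = wdist a L n"
    define q where "q = wdist b L n"
    define Z where "Z = (\<Sum>c\<in>{0..L}. sqrt (p c * q c))"
    have ln_pos: "0 < ln (real n)" and x_pos: "0 < x"
      using big(1) by (auto simp: x_def)
    have c1: "1 \<le> c"
      using big(10) by (simp add: c_def)
    have p0: "p 0 = 1 - u * x" and q0: "q 0 = 1 - v * x"
      by (simp_all add: p_def q_def wdist_def u_def v_def x_def)
    have p: "p l = a l * x" "q l = b l * x" if "1 \<le> l" "l \<le> L" for l
      using that by (simp_all add: p_def q_def wdist_def x_def)
    have small: "u * x < 1" "v * x < 1" "\<mu> * x < 1" "lam * x < 1" "\<mu>\<^sup>2 * x < 2 * \<eta>"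
      using big(2-6) by (simp_all add: x_def)
    have pos: "p l > 0" "q l > 0" if "l \<le> L" for l
      using that small p0 q0 p[of l] ab[of l] x_pos by (cases "l = 0"; simp)+
    have sqrt_pq: "sqrt (p l * q l) = sqrt (a l * b l) * x" if "1 \<le> l" "l \<le> L" for l
      using x_pos by (simp add: p[OF that] real_sqrt_mult)
    have split: "(\<Sum>l\<in>{0..L}. f l) = f 0 + (\<Sum>l=1..L. f l)" for f :: "nat \<Rightarrow> real"
      by (simp add: sum.atLeast_Suc_atMost)
    have Z_eq: "Z = sqrt ((1 - u * x) * (1 - v * x)) + s * x"
      unfolding Z_def split p0 q0 s_def sum_distrib_right
      by (intro arg_cong2[where f = "(+)"] sum.cong refl sqrt_pq) auto
    have Z_ge: "1 - lam * x \<le> Z"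
      unfolding Z_eq lam_def I_eq using uv \<eta> x_pos small
      by (intro hellinger_affinity_ge) (auto simp: \<mu>_def)
    then have Z_pos: "0 < Z"
      using small by linarith
    \<comment> \<open>Arithmetic-geometric mean, colour by colour. It allows the exponent
      \<open>2 * (n - h)\<close> to be replaced by \<open>2 * n\<close> in lower bounds.\<close>
    have Z_le: "Z \<le> 1"
    proof -
      have "Z \<le> (\<Sum>l\<in>{0..L}. (p l + q l) / 2)"
        unfolding Z_def using pos by (intro sum_mono arith_geo_mean_sqrt) (auto simp: less_imp_le)
      also have "\<dots> = ((\<Sum>l\<in>{0..L}. p l) + (\<Sum>l\<in>{0..L}. q l)) / 2"
        by (simp add: sum.distrib flip: sum_divide_distrib)
      also have "\<dots> = 1"
        by (simp add: p_def q_def sum_wdist)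
      finally show ?thesis .
    qed
    define M where "M = (\<Sum>l\<in>{0..L}. sqrt (p l * q l) * (ln (q l) - ln (p l))\<^sup>2)"
    \<comment> \<open>Both logarithms are nonpositive, so their difference is dominated by their
      sum, whose leading coefficient \<open>u + v\<close> is positive whatever the sign of
      \<open>u - v\<close>.\<close>
    have "sqrt (p 0 * q 0) * (ln (q 0) - ln (p 0))\<^sup>2 \<le> 1 * (- ln (p 0) - ln (q 0))\<^sup>2"
    proof (intro mult_mono)
      have "p 0 \<le> 1" "q 0 \<le> 1"
        using uv x_pos by (auto simp: p0 q0)
      with pos[of 0] have "ln (p 0) \<le> 0" "ln (q 0) \<le> 0"
        by auto
      then have "\<bar>ln (q 0) - ln (p 0)\<bar> \<le> \<bar>- ln (p 0) - ln (q 0)\<bar>"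
        by linarith
      then show "(ln (q 0) - ln (p 0))\<^sup>2 \<le> (- ln (p 0) - ln (q 0))\<^sup>2"
        by (simp only: abs_le_square_iff)
      show "sqrt (p 0 * q 0) \<le> 1"
        using pos[of 0] \<open>p 0 \<le> 1\<close> \<open>q 0 \<le> 1\<close> by (simp add: mult_le_one less_imp_le)
    qed (use pos[of 0] in auto)
    moreover have "(\<Sum>l=1..L. sqrt (p l * q l) * (ln (q l) - ln (p l))\<^sup>2) = (V - 1) * x"
    proof -
      \<comment> \<open>The common factor \<open>x\<close> cancels in the ratio, so the log ratios
        of nonzero colours do not depend on \<open>n\<close>.\<close>
      have "ln (q l) - ln (p l) = ln (b l) - ln (a l)" if "1 \<le> l" "l \<le> L" for l
        using ab[OF that] x_pos by (simp add: p[OF that] ln_mult)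
      then show ?thesis
        unfolding V_def sum_distrib_right add_diff_cancel_right'
        by (intro sum.cong) (simp_all add: sqrt_pq)
    qed
    ultimately have M_le: "M \<le> (- ln (1 - u * x) - ln (1 - v * x))\<^sup>2 + V * x"
      unfolding M_def split using x_pos by (simp add: p0 q0 left_diff_distrib)
    have M_nonneg: "0 \<le> M"
      unfolding M_def using pos by (intro sum_nonneg) (auto simp: less_imp_le)
    have moment: "2 * real (n - h) * M \<le> 4 * t\<^sup>2 * Z"
    proof -
      have "2 * real (n - h) * M \<le> 2 * real n * ((- ln (1 - u * x) - ln (1 - v * x))\<^sup>2 + V * x)"
        using M_le M_nonneg by (intro mult_mono) auto
      also have "\<dots> \<le> 4 * t\<^sup>2 * (1 - lam * x)"
        using big(7) by (simp add: x_def t_def)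
      also have "\<dots> \<le> 4 * t\<^sup>2 * Z"
        using Z_ge by (intro mult_left_mono) auto
      finally show ?thesis .
    qed
    have h_le: "real h \<le> real n / c" and h_ge: "real n / c - 1 \<le> real h"
      using c1 by (simp_all add: h_def)
    have "h \<le> n"
      using order_trans[OF h_le, of "real n"] c1 frac_le[of "real n" "real n" 1 c] by simp
    have Z_pow: "exp (- (2 * lam + \<eta>) * ln (real n)) \<le> Z ^ (2 * (n - h))"
    proof -
      have "exp (- (2 * lam + \<eta>) * ln (real n)) \<le> exp (2 * real n * ln (1 - lam * x))"
        using big(8) by (simp add: x_def)
      also have "\<dots> = (1 - lam * x) ^ (2 * n)"
        using small exp_of_nat_mult[of "2 * n" "ln (1 - lam * x)"] by simp
      also have "\<dots> \<le> Z ^ (2 * n)"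
        using Z_ge small by (intro power_mono) auto
      also have "\<dots> \<le> Z ^ (2 * (n - h))"
        using Z_le Z_pos by (intro power_decreasing) auto
      finally show ?thesis .
    qed
    have many: "2 \<le> real h * (exp (- t) * Z ^ (2 * (n - h)) / 2)"
    proof -
      have E: "real n powr (4 * \<eta>) / real n \<le> exp (- t) * Z ^ (2 * (n - h))"
      proof -
        have "real n powr (4 * \<eta>) / real n = exp (- (1 - 4 * \<eta>) * ln (real n))"
          using big(1) by (simp add: powr_def left_diff_distrib exp_diff)
        also have "\<dots> \<le> exp (- t + - (2 * lam + \<eta>) * ln (real n))"
          using mult_right_mono[OF lam(2), of "ln (real n)"] ln_pos
          by (simp add: t_def algebra_simps)
        also have "\<dots> = exp (- t) * exp (- (2 * lam + \<eta>) * ln (real n))"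
          by (rule exp_add)
        also have "\<dots> \<le> exp (- t) * Z ^ (2 * (n - h))"
          using Z_pow by (intro mult_left_mono) auto
        finally show ?thesis .
      qed
      \<comment> \<open>Ensures that rounding \<open>h\<close> down, a loss of at most one vertex,
        costs at most 1 in the product.\<close>
      have E1: "exp (- t) * Z ^ (2 * (n - h)) \<le> 1"
        using \<eta> ln_pos Z_pos Z_le by (intro mult_le_one power_le_one) (auto simp: t_def)
      have "2 \<le> real n powr (4 * \<eta>) / (2 * c) - 1"
      proof -
        have "24 * (u + v) * ln (real n) = 2 * c"
          by (simp add: c_def)
        with big(9) show ?thesis
          by simp
      qed
      also have "real n powr (4 * \<eta>) / (2 * c) = real n / c * (real n powr (4 * \<eta>) / real n / 2)"
        using big(1) by simp
      also have "\<dots> \<le> real n / c * (exp (- t) * Z ^ (2 * (n - h)) / 2)"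
        using E c1 by (intro mult_left_mono divide_right_mono) auto
      also have "real n / c * (exp (- t) * Z ^ (2 * (n - h)) / 2) - 1
          \<le> (real n / c - 1) * (exp (- t) * Z ^ (2 * (n - h)) / 2)"
        using E1 by (simp add: left_diff_distrib)
      also have "\<dots> \<le> real h * (exp (- t) * Z ^ (2 * (n - h)) / 2)"
        using h_ge Z_pos by (intro mult_right_mono) auto
      finally show ?thesis
        by simp
    qed
    have few: "4 * real h * ((u + v) * x) \<le> 1 / 3"
    proof -
      have "4 * real h * ((u + v) * x) \<le> 4 * (real n / c) * ((u + v) * x)"
        using h_le uv x_pos by (intro mult_right_mono mult_left_mono) auto
      also have "\<dots> = 1 / 3"
      proof -
        have "4 * (r / (12 * w * l)) * (w * (l / r)) = 1 / 3"
          if "w > 0" "l > 0" "r > 0" for w l r :: real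
          using that by (simp add: field_simps)
        then show ?thesis
          using big(1) \<open>u + v > 0\<close> ln_pos by (simp add: c_def x_def)
      qed
      finally show ?thesis .
    qed
    show ?case
    \<comment> \<open>Communities 0 and 1 exist because \<open>K\<close> is at least 2, and
      \<open>(u + v) * x\<close> bounds both \<open>u * x\<close> and \<open>v * x\<close>, the
      probabilities of a nonzero colour.\<close>
    proof (rule wsbm_prob_mle_fails_ge[where k = 0 and l = 1 and h = h and \<delta> = "(u + v) * x" and t = t])
      show "balanced K n \<sigma>"
        by (rule big)
      show "1 - (u + v) * x \<le> wdist a L n 0" "1 - (u + v) * x \<le> wdist b L n 0"
        unfolding p_def[symmetric] q_def[symmetric] p0 q0 using uv x_pos by (simp_all add: distrib_right)
    qed (use big(1) assms(4) \<open>h \<le> n\<close> pos few many moment uv x_pos \<eta> ln_pos in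
          \<open>auto simp: p_def q_def Z_def M_def t_def\<close>)
  qed
qed

end
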